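(* Let $X$ be a space. If $X$ is CDP-nonmeager then $X$ is $\Delta_s$-nonmeager. If $X$ is CDP-Baire then $X$ is $\Delta_s$-Baire.
   Context: For a family $\gamma$ of subsets of $X$ and $x\in X$, $\operatorname{st}(x,\gamma)=\bigcup\{U\in\gamma:x\in U\}$. For a collection $\mathcal G$ of families of open subsets of $X$, $B(X,\mathcal G)$ is the set of all $x\in X$ such that $\{\operatorname{st}(x,\gamma):\gamma\in\mathcal G,\ x\in\bigcup\gamma\}$ is a base at $x$. Let $Y\subset X$ and let $\mathcal N$ be the family of all nowhere dense subsets of $X$. If $Y\not\subset\bigcup\mathcal N$, put $\operatorname{Nov}(Y,X)=\infty$ (larger than every cardinal); otherwise $\operatorname{Nov}(Y,X)=\min\{|\mathcal L|:\mathcal L\subset\mathcal N,\ Y\subset\bigcup\mathcal L\}$. $X$ is CDP-nonmeager if there is a collection $\mathcal P$ of families of open subsets of $X$ such that $|\mathcal P|<\operatorname{Nov}(Y,X)$ for $Y=B(X,\mathcal P)$. $X$ is CDP-Baire if every nonempty open subset of $X$ is (with the subspace topology) a CDP-nonmeager space. For $P\subset X\times X$ let $P(x)=\{y:(x,y)\in P\}$; $P$ is a semi-neighborhood of the diagonal if $x\in\operatorname{Int}P(x)$ for all $x\in X$. $X$ is $\Delta_s$-nonmeager (respectively $\Delta_s$-Baire) if for every semi-neighborhood of the diagonal $P$ (and every nonempty open $O\subset X$) there is a nonempty open $W\subset X$ (respectively $W\subset O$) and a dense subset $M$ of $W$ with $M\times W\subset P$. *)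

theory Defs
  imports "HOL-Analysis.Analysis"
begin

unbundle cardinal_syntax

text \<open>Spaces are abstract topologies, so that the subspace on a set \<open>U\<close> is \<open>subtopology X U\<close>;
  no separation axioms are assumed. Cardinalities are compared by \<open>\<le>o\<close> and \<open><o\<close>, because
  \<open>card\<close> vanishes on infinite sets.\<close>

definition nowhere_dense_in :: "'a topology \<Rightarrow> 'a set \<Rightarrow> bool" where
  "nowhere_dense_in X N \<longleftrightarrow> N \<subseteq> topspace X \<and> X interior_of (X closure_of N) = {}"

definition dense_in :: "'a topology \<Rightarrow> 'a set \<Rightarrow> bool" where
  "dense_in X M \<longleftrightarrow> M \<subseteq> topspace X \<and> X closure_of M = topspace X"

definition star :: "'a \<Rightarrow> 'a set set \<Rightarrow> 'a set" where
  "star x \<gamma> = \<Union>{U \<in> \<gamma>. x \<in> U}"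

definition base_at :: "'a topology \<Rightarrow> 'a \<Rightarrow> 'a set set \<Rightarrow> bool" where
  "base_at X x \<B> \<longleftrightarrow>
     (\<forall>V\<in>\<B>. openin X V \<and> x \<in> V) \<and>
     (\<forall>U. openin X U \<and> x \<in> U \<longrightarrow> (\<exists>V\<in>\<B>. V \<subseteq> U))"

definition B_set :: "'a topology \<Rightarrow> 'a set set set \<Rightarrow> 'a set" where
  "B_set X \<G> = {x \<in> topspace X. base_at X x {star x \<gamma> |\<gamma>. \<gamma> \<in> \<G> \<and> x \<in> \<Union>\<gamma>}}"

text \<open>\<open>None\<close> encodes \<open>\<infinity>\<close>. The minimum of a nonempty family of cardinals is determined only up to
  the equivalence \<open>=o\<close>, so an arbitrary representative is chosen.\<close>

definition Nov :: "'a set \<Rightarrow> 'a topology \<Rightarrow> 'a set rel option" where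
  "Nov Y X =
     (if \<not> Y \<subseteq> \<Union>{N. nowhere_dense_in X N} then None
      else let R = {|\<L>| |\<L>. \<L> \<subseteq> {N. nowhere_dense_in X N} \<and> Y \<subseteq> \<Union>\<L>}
           in Some (SOME r. r \<in> R \<and> (\<forall>r'\<in>R. r \<le>o r')))"

lemma Nov_attained:
  assumes "Nov Y X = Some r"
  obtains \<L> where "\<L> \<subseteq> {N. nowhere_dense_in X N}" "Y \<subseteq> \<Union>\<L>" "r = |\<L>|"
    "\<And>\<L>'. \<L>' \<subseteq> {N. nowhere_dense_in X N} \<Longrightarrow> Y \<subseteq> \<Union>\<L>' \<Longrightarrow> r \<le>o |\<L>'|"
proof -
  define R where "R = {|\<L>| |\<L>. \<L> \<subseteq> {N. nowhere_dense_in X N} \<and> Y \<subseteq> \<Union>\<L>}"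
  have cov: "Y \<subseteq> \<Union>{N. nowhere_dense_in X N}" and r: "r = (SOME r. r \<in> R \<and> (\<forall>r'\<in>R. r \<le>o r'))"
    using assms unfolding Nov_def R_def by (auto simp: Let_def split: if_splits)
  have "R \<noteq> {}" "\<forall>r\<in>R. Card_order r"
    using cov unfolding R_def by (auto simp: card_of_Card_order)
  then have "\<exists>r. r \<in> R \<and> (\<forall>r'\<in>R. r \<le>o r')"
    using exists_minim_Card_order[of R] by (simp add: Bex_def)
  then have "r \<in> R \<and> (\<forall>r'\<in>R. r \<le>o r')"
    unfolding r by (rule someI_ex)
  then have "r \<in> R" and min: "\<And>r'. r' \<in> R \<Longrightarrow> r \<le>o r'"
    by auto
  then obtain \<L> where \<L>: "r = |\<L>|" "\<L> \<subseteq> {N. nowhere_dense_in X N}" "Y \<subseteq> \<Union>\<L>"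
    by (auto simp: R_def)
  show thesis
  proof (rule that[OF \<L>(2,3,1)])
    fix \<L>' assume "\<L>' \<subseteq> {N. nowhere_dense_in X N}" "Y \<subseteq> \<Union>\<L>'"
    then have "|\<L>'| \<in> R"
      unfolding R_def by blast
    then show "r \<le>o |\<L>'|"
      by (rule min)
  qed
qed

definition less_Nov :: "'b set \<Rightarrow> 'a set \<Rightarrow> 'a topology \<Rightarrow> bool" where
  "less_Nov A Y X \<longleftrightarrow> (case Nov Y X of None \<Rightarrow> True | Some r \<Rightarrow> |A| <o r)"

definition CDP_nonmeager :: "'a topology \<Rightarrow> bool" where
  "CDP_nonmeager X \<longleftrightarrow>
     (\<exists>\<P>. (\<forall>\<gamma>\<in>\<P>. \<forall>U\<in>\<gamma>. openin X U) \<and> less_Nov \<P> (B_set X \<P>) X)"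

definition CDP_Baire :: "'a topology \<Rightarrow> bool" where
  "CDP_Baire X \<longleftrightarrow>
     (\<forall>U. openin X U \<and> U \<noteq> {} \<longrightarrow> CDP_nonmeager (subtopology X U))"

definition semi_nbhd_diagonal :: "'a topology \<Rightarrow> ('a \<times> 'a) set \<Rightarrow> bool" where
  "semi_nbhd_diagonal X P \<longleftrightarrow>
     P \<subseteq> topspace X \<times> topspace X \<and> (\<forall>x\<in>topspace X. x \<in> X interior_of (P `` {x}))"

definition Delta_s_nonmeager :: "'a topology \<Rightarrow> bool" where
  "Delta_s_nonmeager X \<longleftrightarrow>
     (\<forall>P. semi_nbhd_diagonal X P \<longrightarrow>
        (\<exists>W M. openin X W \<and> W \<noteq> {} \<and> dense_in (subtopology X W) M \<and> M \<times> W \<subseteq> P))"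

definition Delta_s_Baire :: "'a topology \<Rightarrow> bool" where
  "Delta_s_Baire X \<longleftrightarrow>
     (\<forall>P. semi_nbhd_diagonal X P \<longrightarrow>
        (\<forall>Q. openin X Q \<and> Q \<noteq> {} \<longrightarrow>
           (\<exists>W M. openin X W \<and> W \<noteq> {} \<and> W \<subseteq> Q \<and>
                  dense_in (subtopology X W) M \<and> M \<times> W \<subseteq> P)))"

end

theory Submission
  imports Defs
begin

text \<open>Let \<open>P\<close> be a semi-neighborhood of the diagonal and let \<open>\<P>\<close> witness that \<open>X\<close> is CDP-nonmeager.
  Sort the points \<open>x\<close> of \<open>B_set X \<P>\<close> by a family \<open>\<gamma>\<close> that witnesses the base property for the
  neighborhood \<open>P `` {x}\<close>, that is, with \<open>star x \<gamma> \<subseteq> P `` {x}\<close>. At most \<open>|\<P>|\<close> classes then cover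
  \<open>B_set X \<P>\<close>, fewer than the number of nowhere dense sets needed for that, so the class \<open>A\<close> of some
  \<open>\<gamma>\<close> is dense in a nonempty open set \<open>V\<close> (\<open>less_Nov_not_nowhere_dense\<close>). Shrinking \<open>V\<close> to a nonempty
  \<open>W = V \<inter> U\<close> with \<open>U \<in> \<gamma>\<close> makes the relation uniform: every \<open>m \<in> A \<inter> W\<close> has
  \<open>W \<subseteq> U \<subseteq> star m \<gamma> \<subseteq> P `` {m}\<close>. The Baire version is the nonmeager version applied
  to every nonempty open subspace.\<close>

text \<open>The Baire category principle carried by \<open>Nov\<close>, in the form of a pigeonhole argument: if all
  \<open>A i\<close> were nowhere dense, then \<open>A ` I\<close>, whose cardinality is at most \<open>|I|\<close>, would be one of the
  covers over which \<open>Nov Y X\<close> is a minimum.\<close>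

lemma less_Nov_not_nowhere_dense:
  assumes less: "less_Nov I Y X" and cover: "Y \<subseteq> (\<Union>i\<in>I. A i)"
  obtains i where "i \<in> I" "\<not> nowhere_dense_in X (A i)"
proof (rule ccontr)
  assume "\<not> thesis"
  with that have nd: "A ` I \<subseteq> {N. nowhere_dense_in X N}"
    by auto
  show False
  proof (cases "Nov Y X")
    case None
    then have "\<not> Y \<subseteq> \<Union>{N. nowhere_dense_in X N}"
      unfolding Nov_def by (auto simp: Let_def split: if_splits)
    moreover have "Y \<subseteq> \<Union>{N. nowhere_dense_in X N}"
      using cover Union_mono[OF nd] by (rule subset_trans)
    ultimately show False
      by contradiction
  next
    case (Some r)
    have "Y \<subseteq> \<Union>(A ` I)"
      using cover .
    with Some nd have "r \<le>o |A ` I|"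
      using Nov_attained by metis
    then have "r \<le>o |I|"
      using card_of_image by (rule ordLeq_transitive)
    moreover have "|I| <o r"
      using less Some by (simp add: less_Nov_def)
    ultimately show False
      using not_ordLess_ordLeq by auto
  qed
qed

lemma dense_in_Int_open:
  assumes V: "openin X V" "V \<subseteq> X closure_of A" and W: "openin X W" "W \<subseteq> V"
  shows "dense_in (subtopology X W) (A \<inter> W)"
proof -
  have WX: "W \<subseteq> topspace X"
    using W openin_subset by blast
  have "W \<inter> X closure_of A \<subseteq> X closure_of (W \<inter> A)"
    using W(1) openin_Int_closure_of_subset by blast
  then have "W \<subseteq> X closure_of (A \<inter> W)"
    using V W by (auto simp: Int_commute)
  then show ?thesis
    using WX by (auto simp: dense_in_def closure_of_subtopology Int_absorb1 Int_absorb2)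
qed

text \<open>The neighborhoods \<open>P `` {x}\<close> depend on \<open>x\<close> without any control. The stars supply it: the points
  of one \<open>U \<in> \<gamma>\<close> all have \<open>U\<close> in their stars, so those whose star fits into \<open>P `` {x}\<close> share the
  neighborhood \<open>U\<close>. Category provides a \<open>\<gamma>\<close> for which such points are somewhere dense.\<close>

lemma CDP_nonmeager_imp_Delta_s_nonmeager:
  assumes "CDP_nonmeager X"
  shows "Delta_s_nonmeager X"
  unfolding Delta_s_nonmeager_def
proof (intro allI impI)
  fix P assume P: "semi_nbhd_diagonal X P"
  obtain \<P> where op: "\<And>\<gamma> U. \<gamma> \<in> \<P> \<Longrightarrow> U \<in> \<gamma> \<Longrightarrow> openin X U"
    and less: "less_Nov \<P> (B_set X \<P>) X"
    using assms unfolding CDP_nonmeager_def by blast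
  define A where "A \<gamma> = {x \<in> topspace X. x \<in> \<Union>\<gamma> \<and> star x \<gamma> \<subseteq> P `` {x}}" for \<gamma>
  have "B_set X \<P> \<subseteq> (\<Union>\<gamma>\<in>\<P>. A \<gamma>)"
  proof
    fix x assume x: "x \<in> B_set X \<P>"
    then have xX: "x \<in> topspace X"
      by (simp add: B_set_def)
    then have "x \<in> X interior_of (P `` {x})"
      using P by (simp add: semi_nbhd_diagonal_def)
    moreover have "base_at X x {star x \<gamma> |\<gamma>. \<gamma> \<in> \<P> \<and> x \<in> \<Union>\<gamma>}"
      using x by (simp add: B_set_def)
    ultimately have "\<exists>V\<in>{star x \<gamma> |\<gamma>. \<gamma> \<in> \<P> \<and> x \<in> \<Union>\<gamma>}. V \<subseteq> X interior_of (P `` {x})"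
      by (simp only: base_at_def openin_interior_of simp_thms)
    then obtain \<gamma> where "\<gamma> \<in> \<P>" "x \<in> \<Union>\<gamma>" "star x \<gamma> \<subseteq> X interior_of (P `` {x})"
      by blast
    then show "x \<in> (\<Union>\<gamma>\<in>\<P>. A \<gamma>)"
      using xX interior_of_subset[of X "P `` {x}"] unfolding A_def by blast
  qed
  then obtain \<gamma> where \<gamma>: "\<gamma> \<in> \<P>" "\<not> nowhere_dense_in X (A \<gamma>)"
    using less_Nov_not_nowhere_dense[OF less] by blast
  define V where "V = X interior_of (X closure_of (A \<gamma>))"
  have V: "openin X V" "V \<subseteq> X closure_of (A \<gamma>)" "V \<noteq> {}"
    using \<gamma> by (auto simp: V_def interior_of_subset nowhere_dense_in_def A_def)
  then have "V \<inter> A \<gamma> \<noteq> {}"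
    using openin_Int_closure_of_eq_empty[OF V(1), of "A \<gamma>"] by (simp add: Int_absorb2)
  then obtain x where x: "x \<in> V" "x \<in> A \<gamma>"
    by blast
  then obtain U where U: "U \<in> \<gamma>" "x \<in> U"
    by (auto simp: A_def)
  \<comment> \<open>\<open>V\<close> keeps \<open>A \<gamma>\<close> dense, \<open>U\<close> keeps the set inside the star of each of its points.\<close>
  define W where "W = V \<inter> U"
  have W: "openin X W" "W \<noteq> {}"
    using V op[OF \<gamma>(1) U(1)] x U by (auto simp: W_def)
  have "dense_in (subtopology X W) (A \<gamma> \<inter> W)"
    using dense_in_Int_open[OF V(1,2) W(1)] by (simp add: W_def)
  moreover have "(A \<gamma> \<inter> W) \<times> W \<subseteq> P"
    using U(1) by (auto simp: W_def A_def star_def)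
  ultimately show "\<exists>W M. openin X W \<and> W \<noteq> {} \<and> dense_in (subtopology X W) M \<and> M \<times> W \<subseteq> P"
    using W by blast
qed

lemma semi_nbhd_diagonal_subtopology:
  assumes P: "semi_nbhd_diagonal X P" and Q: "openin X Q"
  shows "semi_nbhd_diagonal (subtopology X Q) (P \<inter> Q \<times> Q)"
proof -
  have QX: "Q \<subseteq> topspace X"
    using Q by (rule openin_subset)
  have "x \<in> subtopology X Q interior_of ((P \<inter> Q \<times> Q) `` {x})" if "x \<in> Q" for x
  proof -
    let ?I = "Q \<inter> X interior_of (P `` {x})"
    have "x \<in> ?I"
      using that QX P by (auto simp: semi_nbhd_diagonal_def)
    moreover have "openin (subtopology X Q) ?I"
      by (simp add: openin_subtopology_Int2)
    moreover have "?I \<subseteq> (P \<inter> Q \<times> Q) `` {x}"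
      using that interior_of_subset[of X "P `` {x}"] by blast
    ultimately show ?thesis
      using interior_of_maximal by blast
  qed
  then show ?thesis
    using QX by (simp add: semi_nbhd_diagonal_def Int_absorb1)
qed

text \<open>The rectangle found inside the open subspace \<open>Q\<close> serves for \<open>X\<close>, since open subsets of \<open>Q\<close> are
  open in \<open>X\<close> and density in \<open>W\<close> depends only on the topology of \<open>W\<close>.\<close>

lemma Delta_s_Baire_if_open_subspaces_nonmeager:
  assumes sub: "\<And>Q. openin X Q \<Longrightarrow> Q \<noteq> {} \<Longrightarrow> Delta_s_nonmeager (subtopology X Q)"
  shows "Delta_s_Baire X"
  unfolding Delta_s_Baire_def
proof (intro allI impI, elim conjE)
  fix P Q assume P: "semi_nbhd_diagonal X P" and Q: "openin X Q" "Q \<noteq> {}"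
  obtain W M where W: "openin (subtopology X Q) W" "W \<noteq> {}"
    and M: "dense_in (subtopology (subtopology X Q) W) M" "M \<times> W \<subseteq> P \<inter> Q \<times> Q"
    using sub[OF Q] semi_nbhd_diagonal_subtopology[OF P Q(1)]
    unfolding Delta_s_nonmeager_def by blast
  have "openin X W" "W \<subseteq> Q"
    using W(1) Q(1) by (auto simp: openin_open_subtopology)
  moreover have "dense_in (subtopology X W) M"
    using M(1) \<open>W \<subseteq> Q\<close> by (simp add: subtopology_subtopology Int_absorb1)
  ultimately show "\<exists>W M. openin X W \<and> W \<noteq> {} \<and> W \<subseteq> Q \<and>
      dense_in (subtopology X W) M \<and> M \<times> W \<subseteq> P"
    using W(2) M(2) by blast
qed

theorem proposition7p6:
  fixes X :: "'a topology"
  shows "(CDP_nonmeager X \<longrightarrow> Delta_s_nonmeager X) \<and> (CDP_Baire X \<longrightarrow> Delta_s_Baire X)"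
proof (intro conjI impI)
  assume "CDP_nonmeager X"
  then show "Delta_s_nonmeager X"
    by (rule CDP_nonmeager_imp_Delta_s_nonmeager)
next
  assume baire: "CDP_Baire X"
  show "Delta_s_Baire X"
  proof (rule Delta_s_Baire_if_open_subspaces_nonmeager)
    fix Q assume "openin X Q" "Q \<noteq> {}"
    with baire have "CDP_nonmeager (subtopology X Q)"
      by (simp add: CDP_Baire_def)
    then show "Delta_s_nonmeager (subtopology X Q)"
      by (rule CDP_nonmeager_imp_Delta_s_nonmeager)
  qed
qed

end
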